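(* Let $\Gamma$ be a unicyclic signed graph of order $n$. Then: (1) $\eta(\Gamma)=n-2$ if and only if $\Gamma$ is the balanced cycle $C_4$ (i.e. the underlying graph of $\Gamma$ is the cycle on $4$ vertices and this cycle is positive). (2) $\eta(\Gamma)=n-3$ if and only if $\Gamma$ is the cycle $C_3$ (i.e. the underlying graph of $\Gamma$ is the cycle on $3$ vertices, with an arbitrary sign labelling).
   Context: A signed graph $\Gamma=(G,\sigma)$ consists of a finite simple graph $G=(V,E)$ (its underlying graph) and a map $\sigma:E\to\{+,-\}$. Its adjacency matrix is $A(\Gamma)=(a_{ij}^\sigma)$ with $a_{ij}^\sigma=\sigma(v_iv_j)a_{ij}$ (i.e. $\pm1$ according to the sign of the edge $v_iv_j$, and $0$ if $v_i,v_j$ are not adjacent), where $(a_{ij})$ is the adjacency matrix of $G$. The nullity $\eta(\Gamma)$ is the multiplicity of the eigenvalue $0$ of $A(\Gamma)$. The order is the number of vertices. The sign of a cycle $C$ is $\prod_{e\in C}\sigma(e)$; a cycle is positive or negative according to its sign. A signed graph is balanced if all its cycles are positive, and unbalanced otherwise. A signed graph is unicyclic if its underlying graph is connected and contains exactly one cycle. $C_m$ denotes the cycle of order $m$. *)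

theory Defs
  imports "Jordan_Normal_Form.Char_Poly"
begin

record 'a ugraph =
  verts :: "'a set"
  edges :: "'a set set"

text \<open>The signs are the integers \<open>1\<close> and \<open>-1\<close>.  Values of \<open>edge_sign\<close> outside the edge set are
  irrelevant.\<close>

record 'a signed_graph = "'a ugraph" +
  edge_sign :: "'a set \<Rightarrow> int"

definition simple_graph :: "('a, 'b) ugraph_scheme \<Rightarrow> bool" where
  "simple_graph G \<longleftrightarrow> finite (verts G) \<and>
     (\<forall>e \<in> edges G. \<exists>u \<in> verts G. \<exists>v \<in> verts G. u \<noteq> v \<and> e = {u, v})"

definition signed_graph :: "'a signed_graph \<Rightarrow> bool" where
  "signed_graph \<Gamma> \<longleftrightarrow> simple_graph \<Gamma> \<and> (\<forall>e \<in> edges \<Gamma>. edge_sign \<Gamma> e \<in> {1, -1})"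

definition connected_graph :: "('a, 'b) ugraph_scheme \<Rightarrow> bool" where
  "connected_graph G \<longleftrightarrow> verts G \<noteq> {} \<and>
     (\<forall>u \<in> verts G. \<forall>v \<in> verts G. (u, v) \<in> {(x, y). {x, y} \<in> edges G}\<^sup>*)"

text \<open>The edges of the closed walk \<open>c\<^sub>0, c\<^sub>1, \<dots>, c\<^sub>k\<^sub>-\<^sub>1, c\<^sub>0\<close>.\<close>

definition cycle_edges :: "'a list \<Rightarrow> 'a set set" where
  "cycle_edges cs = {{cs ! i, cs ! (Suc i mod length cs)} | i. i < length cs}"

text \<open>A cycle of a graph is a subgraph, so it does not depend on a starting vertex or a direction
  of traversal; it is represented by its edge set, which determines its vertices.\<close>

definition is_cycle :: "('a, 'b) ugraph_scheme \<Rightarrow> 'a set set \<Rightarrow> bool" where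
  "is_cycle G C \<longleftrightarrow> C \<subseteq> edges G \<and>
     (\<exists>cs. distinct cs \<and> 3 \<le> length cs \<and> set cs \<subseteq> verts G \<and> C = cycle_edges cs)"

text \<open>The graph \<open>G\<close> is (isomorphic to) \<open>C\<^sub>m\<close>; meaningful for \<open>m \<ge> 3\<close>.\<close>

definition is_cycle_graph :: "nat \<Rightarrow> ('a, 'b) ugraph_scheme \<Rightarrow> bool" where
  "is_cycle_graph m G \<longleftrightarrow>
     (\<exists>cs. distinct cs \<and> length cs = m \<and> set cs = verts G \<and> edges G = cycle_edges cs)"

definition unicyclic :: "('a, 'b) ugraph_scheme \<Rightarrow> bool" where
  "unicyclic G \<longleftrightarrow> connected_graph G \<and> (\<exists>!C. is_cycle G C)"

definition cycle_sign :: "'a signed_graph \<Rightarrow> 'a set set \<Rightarrow> int" where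
  "cycle_sign \<Gamma> C = (\<Prod>e\<in>C. edge_sign \<Gamma> e)"

definition balanced :: "'a signed_graph \<Rightarrow> bool" where
  "balanced \<Gamma> \<longleftrightarrow> (\<forall>C. is_cycle \<Gamma> C \<longrightarrow> cycle_sign \<Gamma> C = 1)"

definition adj :: "('a, 'b) ugraph_scheme \<Rightarrow> 'a \<Rightarrow> 'a \<Rightarrow> int" where
  "adj G u v = (if {u, v} \<in> edges G then 1 else 0)"

definition signed_adj :: "'a signed_graph \<Rightarrow> 'a \<Rightarrow> 'a \<Rightarrow> int" where
  "signed_adj \<Gamma> u v = edge_sign \<Gamma> {u, v} * adj \<Gamma> u v"

definition adj_matrix :: "'a signed_graph \<Rightarrow> 'a list \<Rightarrow> real mat" where
  "adj_matrix \<Gamma> vs =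
     mat (length vs) (length vs) (\<lambda>(i, j). real_of_int (signed_adj \<Gamma> (vs ! i) (vs ! j)))"

text \<open>The choice of the enumeration of the vertices is immaterial, see \<open>nullity_eq\<close> below.\<close>

definition nullity :: "'a signed_graph \<Rightarrow> nat" where
  "nullity \<Gamma> =
     order 0 (char_poly (adj_matrix \<Gamma> (SOME vs. distinct vs \<and> set vs = verts \<Gamma>)))"

lemma sum_nth_delta:
  fixes f :: "'a \<Rightarrow> real"
  assumes "distinct vs" "x \<in> set vs"
  shows "(\<Sum>k = 0..<length vs. (if x = vs ! k then 1 else 0) * f (vs ! k)) = f x"
    and "(\<Sum>k = 0..<length vs. f (vs ! k) * (if vs ! k = x then 1 else 0)) = f x"
proof -
  have bij: "bij_betw ((!) vs) {0..<length vs} (set vs)"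
    using bij_betw_nth[OF assms(1), of "{0..<length vs}" "set vs"] by (simp add: atLeast0LessThan)
  show "(\<Sum>k = 0..<length vs. (if x = vs ! k then 1 else 0) * f (vs ! k)) = f x"
    using sum.reindex_bij_betw[OF bij, of "\<lambda>y. (if x = y then 1 else 0) * f y"] assms(2)
    by (simp add: if_distrib[of "\<lambda>c. c * _"] cong: if_cong)
  show "(\<Sum>k = 0..<length vs. f (vs ! k) * (if vs ! k = x then 1 else 0)) = f x"
    using sum.reindex_bij_betw[OF bij, of "\<lambda>y. f y * (if y = x then 1 else 0)"] assms(2)
    by (simp add: if_distrib[of "\<lambda>c. _ * c"] cong: if_cong)
qed

lemma similar_adj_matrix:
  assumes vs: "distinct vs" "set vs = V" and ws: "distinct ws" "set ws = V"
  shows "similar_mat (adj_matrix \<Gamma> ws) (adj_matrix \<Gamma> vs)"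
proof -
  define n where "n = length vs"
  have n: "length vs = n" "length ws = n"
    using distinct_card[OF vs(1)] distinct_card[OF ws(1)] vs(2) ws(2) by (simp_all add: n_def)
  define M :: "'a list \<Rightarrow> 'a list \<Rightarrow> real mat" where
    "M = (\<lambda>us ts. mat n n (\<lambda>(i, j). if us ! i = ts ! j then 1 else 0))"
  have MM: "M us ts * M ts us = 1\<^sub>m n"
    if "distinct us" "set us = V" "distinct ts" "set ts = V" "length us = n" "length ts = n"
    for us ts
  proof (intro eq_matI)
    fix i j assume ij: "i < dim_row (1\<^sub>m n :: real mat)" "j < dim_col (1\<^sub>m n :: real mat)"
    have mem: "us ! i \<in> set ts"
      using that ij by (metis index_one_mat(2) nth_mem)
    have "(\<Sum>k = 0..<n. (if us ! i = ts ! k then 1 else 0) * (if ts ! k = us ! j then 1 else 0)) =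
        (if us ! i = us ! j then 1 else (0 :: real))"
      using sum_nth_delta(1)[OF that(3) mem, of "\<lambda>y. if y = us ! j then 1 else 0"]
      unfolding that(6) .
    then show "(M us ts * M ts us) $$ (i, j) = 1\<^sub>m n $$ (i, j)"
      using that ij by (simp add: M_def scalar_prod_def nth_eq_iff_index_eq)
  qed (simp_all add: M_def)
  have mem: "ws ! i \<in> set vs" if "i < n" for i
    using that vs(2) ws(2) n nth_mem by metis
  have "M ws vs * adj_matrix \<Gamma> vs =
      mat n n (\<lambda>(i, j). real_of_int (signed_adj \<Gamma> (ws ! i) (vs ! j)))"
  proof (intro eq_matI; clarsimp simp: M_def adj_matrix_def scalar_prod_def n)
    fix i j assume "i < n"
    then show "(\<Sum>k = 0..<n. (if ws ! i = vs ! k then 1 else 0) *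
        real_of_int (signed_adj \<Gamma> (vs ! k) (vs ! j))) = real_of_int (signed_adj \<Gamma> (ws ! i) (vs ! j))"
      using sum_nth_delta(1)[OF vs(1) mem, of i "\<lambda>y. real_of_int (signed_adj \<Gamma> y (vs ! j))"]
      unfolding n by blast
  qed
  moreover have "mat n n (\<lambda>(i, j). real_of_int (signed_adj \<Gamma> (ws ! i) (vs ! j))) * M vs ws =
      adj_matrix \<Gamma> ws"
  proof (intro eq_matI; clarsimp simp: M_def adj_matrix_def scalar_prod_def n)
    fix i j assume "j < n"
    then show "(\<Sum>k = 0..<n. real_of_int (signed_adj \<Gamma> (ws ! i) (vs ! k)) *
        (if vs ! k = ws ! j then 1 else 0)) = real_of_int (signed_adj \<Gamma> (ws ! i) (ws ! j))"
      using sum_nth_delta(2)[OF vs(1) mem, of j "\<lambda>y. real_of_int (signed_adj \<Gamma> (ws ! i) y)"]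
      unfolding n by blast
  qed
  ultimately have "M ws vs * adj_matrix \<Gamma> vs * M vs ws = adj_matrix \<Gamma> ws"
    by simp
  moreover have "M ws vs * M vs ws = 1\<^sub>m n" "M vs ws * M ws vs = 1\<^sub>m n"
    using MM vs ws n by blast+
  ultimately have "similar_mat_wit (adj_matrix \<Gamma> ws) (adj_matrix \<Gamma> vs) (M ws vs) (M vs ws)"
    using n by (simp add: similar_mat_wit_def Let_def M_def adj_matrix_def)
  then show ?thesis unfolding similar_mat_def by blast
qed

lemma nullity_eq:
  assumes "distinct vs" "set vs = verts \<Gamma>"
  shows "nullity \<Gamma> = order 0 (char_poly (adj_matrix \<Gamma> vs))"
proof -
  let ?ws = "SOME vs. distinct vs \<and> set vs = verts \<Gamma>"
  have "distinct ?ws \<and> set ?ws = verts \<Gamma>" by (rule someI) (use assms in simp)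
  then show ?thesis
    using char_poly_similar[OF similar_adj_matrix[of vs "verts \<Gamma>" ?ws \<Gamma>]] assms
    by (simp add: nullity_def)
qed

end

theory Submission
  imports
    Defs
    "Jordan_Normal_Form.Jordan_Normal_Form_Existence"
    "Jordan_Normal_Form.Jordan_Normal_Form_Uniqueness"
    "Jordan_Normal_Form.DL_Rank"
begin

text \<open>
  The nullity counts \<open>0\<close> as a root of the characteristic polynomial.  The adjacency matrix \<open>A\<close> is
  real and symmetric, so this algebraic multiplicity equals the dimension of the kernel, and a
  nonsingular principal \<open>k \<times> k\<close> submatrix of \<open>A\<close> forces \<open>\<eta> + k \<le> n\<close>
  (\<open>order_zero_char_poly_add_minor_le\<close>, \<open>nullity_add_minor_le\<close>).  Both parts of the theorem follow
  from the claim that \<open>\<eta> \<ge> n - 3\<close> leaves only \<open>C\<^sub>3\<close> and the balanced \<open>C\<^sub>4\<close>, whose nullities are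
  \<open>0\<close> and \<open>2\<close>.

  The claim is a search for four vertices with a nonsingular principal submatrix.  Such a submatrix is
  symmetric with zero diagonal; if \<open>p, q, r\<close> denote the products of its entries along the three
  perfect matchings of the four vertices, its determinant is
  \<open>p\<^sup>2 + q\<^sup>2 + r\<^sup>2 - 2pq - 2pr - 2qr\<close>, which is \<open>(p - r)\<^sup>2\<close> when \<open>q = 0\<close>.  So four vertices that
  carry exactly one perfect matching will do.  Let \<open>c\<^sub>0, c\<^sub>1, \<dots>\<close> be the unique cycle.

  \<^item> If some vertex lies off the cycle, connectedness gives one, \<open>x\<close>, that is adjacent to the cycle,
    say to \<open>c\<^sub>0\<close>.  Among \<open>x, c\<^sub>0, c\<^sub>1, c\<^sub>2\<close> the only matching is \<open>xc\<^sub>0, c\<^sub>1c\<^sub>2\<close>, as an edge \<open>xc\<^sub>1\<close> or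
    \<open>xc\<^sub>2\<close> would close a second cycle.
  \<^item> If the cycle has at least five vertices, then \<open>c\<^sub>0, c\<^sub>1, c\<^sub>2, c\<^sub>3\<close> induce a path, because a chord
    would close a shorter cycle.
  \<^item> If the cycle has four vertices and exhausts the graph, its four vertices carry the two matchings
    \<open>c\<^sub>0c\<^sub>1, c\<^sub>2c\<^sub>3\<close> and \<open>c\<^sub>0c\<^sub>3, c\<^sub>1c\<^sub>2\<close>.  Then \<open>p, r = \<plusminus>1\<close>, and \<open>p - r\<close> vanishes precisely when
    \<open>pr\<close>, the sign of the cycle, is \<open>1\<close>.
\<close>

section \<open>Principal minors and the multiplicity of the eigenvalue zero\<close>

text \<open>
  A kernel vector supported on the first \<open>k\<close> coordinates is a kernel vector of the leading block.
  Vanishing outside these coordinates imposes only \<open>n - k\<close> linear conditions, so a kernel of larger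
  dimension contains a nonzero vector of this kind.
\<close>

lemma kernel_dim_add_minor_le:
  fixes A :: "'a :: field mat"
  assumes A: "A \<in> carrier_mat n n" and k: "k \<le> n"
    and minor: "det (mat k k (\<lambda>(i, j). A $$ (i, j))) \<noteq> 0"
  shows "kernel_dim A + k \<le> n"
proof (rule ccontr)
  assume less: "\<not> kernel_dim A + k \<le> n"
  interpret K: kernel n n A by unfold_locales (rule A)
  obtain B where B: "finite B" "K.basis B" using kernel_basis_exists[OF A] by blast
  have B_ker: "B \<subseteq> mat_kernel A" and indep: "\<not> K.lin_dep B"
    using B(2) unfolding K.Ker.basis_def by auto
  obtain bs where bs: "set bs = B" "distinct bs" using finite_distinct_list[OF B(1)] by blast
  define m where "m = length bs"
  define P where "P = mat_of_cols n bs"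
  have m: "m = kernel_dim A"
    using K.Ker.dim_basis[OF B] distinct_card[OF bs(2)] bs(1) by (simp add: m_def)
  have B_carrier: "set bs \<subseteq> carrier_vec n"
    using B_ker mat_kernel_carrier[OF A] bs(1) by blast
  have P: "P \<in> carrier_mat n m" and cols_P: "cols P = bs"
    using B_carrier by (simp_all add: P_def m_def cols_mat_of_cols)
  \<comment> \<open>The columns of \<open>P\<close> form a basis of the kernel.  \<open>M\<close> consists of the rows of \<open>P\<close> below the leading
    \<open>k\<close>, padded with zero rows to a square matrix so that its determinant can be used.\<close>
  define M where "M = mat m m (\<lambda>(i, j). if i < n - k then P $$ (i + k, j) else 0)"
  have M: "M \<in> carrier_mat m m" by (simp add: M_def)
  have nkm: "n - k < m" using less m k by simp
  have "det M = 0"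
  proof (subst laplace_expansion_row[OF M nkm], rule sum.neutral, intro ballI)
    fix j assume "j \<in> {..<m}"
    then show "M $$ (n - k, j) * cofactor M (n - k) j = 0"
      using nkm by (simp add: M_def)
  qed
  then obtain c where c: "c \<in> carrier_vec m" "c \<noteq> 0\<^sub>v m" "M *\<^sub>v c = 0\<^sub>v m"
    using det_0_iff_vec_prod_zero_field[OF M] by blast
  define x where "x = P *\<^sub>v c"
  have x: "x \<in> carrier_vec n" unfolding x_def by (rule mult_mat_vec_carrier[OF P c(1)])
  have "x \<noteq> 0\<^sub>v n"
    using K.NC.lin_depI[OF P c(1,2)] indep K.lindep_same[OF B_ker] cols_P bs by (auto simp: x_def)
  have tail: "x $ i = 0" if "k \<le> i" "i < n" for i
  proof -
    have lt: "i - k < m" using that nkm by simp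
    have "row P i = row M (i - k)" using that nkm P M by (intro eq_vecI) (auto simp: M_def)
    then have "x $ i = (M *\<^sub>v c) $ (i - k)" using that P M lt by (simp add: x_def)
    then show ?thesis using c(3) lt by simp
  qed
  have Ax: "A *\<^sub>v x = 0\<^sub>v n"
  proof -
    have AP: "A * P = 0\<^sub>m n m"
    proof (rule eq_matI)
      fix i j assume "i < dim_row (0\<^sub>m n m :: 'a mat)" "j < dim_col (0\<^sub>m n m :: 'a mat)"
      then have ij: "i < n" "j < m" by auto
      have "col P j = bs ! j" using ij P cols_P by (metis carrier_matD(2) cols_nth)
      then have "A *\<^sub>v col P j = 0\<^sub>v n"
        using mat_kernelD(2)[OF A] B_ker bs(1) ij by (metis m_def nth_mem subsetD)
      moreover have "(A * P) $$ (i, j) = (A *\<^sub>v col P j) $ i" using ij A P by simp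
      ultimately show "(A * P) $$ (i, j) = 0\<^sub>m n m $$ (i, j)" using ij by simp
    qed (use A P in auto)
    have "A *\<^sub>v x = (A * P) *\<^sub>v c" using A P c(1) by (simp add: x_def)
    then show ?thesis using AP c(1) by (intro eq_vecI) (auto simp: scalar_prod_def)
  qed
  let ?L = "mat k k (\<lambda>(i, j). A $$ (i, j))"
  define y where "y = vec k (\<lambda>i. x $ i)"
  have "?L *\<^sub>v y = 0\<^sub>v k"
  proof (rule eq_vecI)
    fix i assume "i < dim_vec (0\<^sub>v k :: 'a vec)"
    then have i: "i < k" by simp
    have "0 = (A *\<^sub>v x) $ i" using Ax i k by simp
    also have "\<dots> = (\<Sum>j = 0..<n. A $$ (i, j) * x $ j)"
      using i k A x by (simp add: scalar_prod_def)
    also have "\<dots> = (\<Sum>j = 0..<k. A $$ (i, j) * x $ j)"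
      using tail k by (intro sum.mono_neutral_right) auto
    also have "\<dots> = (?L *\<^sub>v y) $ i"
      using i by (simp add: scalar_prod_def y_def)
    finally show "(?L *\<^sub>v y) $ i = 0\<^sub>v k $ i" using i by simp
  qed (simp add: y_def)
  moreover have "y \<noteq> 0\<^sub>v k"
  proof
    assume y0: "y = 0\<^sub>v k"
    have "x $ i = 0" if "i < n" for i
    proof (cases "i < k")
      case True
      then show ?thesis using arg_cong[OF y0, of "\<lambda>v. v $ i"] by (simp add: y_def)
    qed (use tail that in simp)
    then have "x = 0\<^sub>v n" using x by (intro eq_vecI) auto
    then show False using \<open>x \<noteq> 0\<^sub>v n\<close> by simp
  qed
  moreover have "y \<in> carrier_vec k" by (simp add: y_def)
  ultimately show False
    using minor det_0_iff_vec_prod_zero_field[of ?L k] by auto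
qed

text \<open>
  The multiplicity is the dimension of the generalised eigenspace \<open>ker A\<^sup>k\<close> for large \<open>k\<close>, and the
  chain of these kernels is already stationary at \<open>k = 1\<close>.
\<close>

lemma order_zero_char_poly_eq_kernel_dim:
  fixes A :: "complex mat"
  assumes A: "A \<in> carrier_mat n n"
    and ker: "\<And>v. v \<in> carrier_vec n \<Longrightarrow> A *\<^sub>v (A *\<^sub>v v) = 0\<^sub>v n \<Longrightarrow> A *\<^sub>v v = 0\<^sub>v n"
  shows "Polynomial.order 0 (char_poly A) = kernel_dim A"
proof -
  obtain as where "char_poly A = (\<Prod>a\<leftarrow>as. [:- a, 1:])"
    using char_poly_factorized[OF A] by blast
  then obtain n_as where jnf: "jordan_nf A n_as" using jordan_nf_exists[OF A] by blast
  have cm: "char_matrix A 0 = A"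
    using A by (intro eq_matI) (auto simp: char_matrix_def)
  have pow: "A ^\<^sub>m k \<in> carrier_mat n n" for k using A by simp
  have ker_pow: "mat_kernel (A ^\<^sub>m Suc k) = mat_kernel A" for k
  proof (induction k)
    case 0
    then show ?case using A by simp
  next
    case (Suc k)
    have "v \<in> mat_kernel (A ^\<^sub>m Suc (Suc k)) \<longleftrightarrow> v \<in> mat_kernel A" for v
    proof
      assume v: "v \<in> mat_kernel (A ^\<^sub>m Suc (Suc k))"
      have vc: "v \<in> carrier_vec n" using v mat_kernelD[OF pow] by blast
      have "A ^\<^sub>m Suc (Suc k) *\<^sub>v v = A ^\<^sub>m Suc k *\<^sub>v (A *\<^sub>v v)"
        using pow[of "Suc k"] A vc by simp
      then have "A ^\<^sub>m Suc k *\<^sub>v (A *\<^sub>v v) = 0\<^sub>v n" using mat_kernelD(2)[OF pow v] by simp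
      then have "A *\<^sub>v v \<in> mat_kernel (A ^\<^sub>m Suc k)"
        using mat_kernelI[OF pow] A vc by (meson mult_mat_vec_carrier)
      then have "A *\<^sub>v (A *\<^sub>v v) = 0\<^sub>v n" unfolding Suc.IH using mat_kernelD(2)[OF A] by blast
      then show "v \<in> mat_kernel A" using ker vc mat_kernelI[OF A] by blast
    next
      assume v: "v \<in> mat_kernel A"
      have vc: "v \<in> carrier_vec n" using v mat_kernelD[OF A] by blast
      have "A ^\<^sub>m Suc (Suc k) *\<^sub>v v = A ^\<^sub>m Suc k *\<^sub>v (A *\<^sub>v v)"
        using pow[of "Suc k"] A vc by simp
      also have "\<dots> = 0\<^sub>v n"
        unfolding mat_kernelD(2)[OF A v] using A pow[of k] by (intro eq_vecI) (auto simp: scalar_prod_def)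
      finally show "v \<in> mat_kernel (A ^\<^sub>m Suc (Suc k))" using mat_kernelI[OF pow vc] by blast
    qed
    then show ?case by blast
  qed
  have kd: "kernel_dim (A ^\<^sub>m Suc k) = kernel_dim A" for k
    unfolding kernel_dim_def ker_pow using A pow[of "Suc k"] by (metis carrier_matD(2))
  define ns where "ns = map fst (filter (\<lambda>na. snd na = 0) n_as)"
  have ns': "map fst [(n, e)\<leftarrow>n_as . e = 0] = ns"
    unfolding ns_def by (simp add: case_prod_unfold)
  \<comment> \<open>\<open>ns\<close> lists the sizes of the Jordan blocks for \<open>0\<close>.  No block is larger than the sum of all of
    them, so taking this sum plus one as exponent makes each \<open>min\<close> the full block size.\<close>
  have "sum_list ns = sum_list (map (\<lambda>n. min (Suc (sum_list ns)) n) ns)"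
  proof -
    have "n \<le> sum_list ns" if "n \<in> set ns" for n using that by (intro member_le_sum_list) simp_all
    then have "map (\<lambda>n. min (Suc (sum_list ns)) n) ns = ns"
      by (intro map_idI) (fastforce simp: min_def)
    then show ?thesis by simp
  qed
  also have "\<dots> = dim_gen_eigenspace A 0 (Suc (sum_list ns))"
    using dim_gen_eigenspace[OF jnf, of 0 "Suc (sum_list ns)"] unfolding ns' by simp
  also have "\<dots> = kernel_dim A"
    unfolding dim_gen_eigenspace_def cm by (rule kd)
  finally show ?thesis unfolding jordan_nf_order[OF jnf] ns_def .
qed

text \<open>
  For a Hermitian matrix \<open>A\<close>, the squared norm of \<open>Av\<close> is the inner product of \<open>A\<^sup>2v\<close> and \<open>v\<close>.  The
  vectors are complex because the Jordan normal form is taken over the complex numbers.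
\<close>

lemma kernel_square_of_real_symmetric:
  fixes A :: "real mat"
  assumes A: "A \<in> carrier_mat n n" and sym: "A\<^sup>T = A"
    and v: "v \<in> carrier_vec n"
    and zero: "map_mat complex_of_real A *\<^sub>v (map_mat complex_of_real A *\<^sub>v v) = 0\<^sub>v n"
  shows "map_mat complex_of_real A *\<^sub>v v = 0\<^sub>v n"
proof -
  let ?A = "map_mat complex_of_real A"
  have A': "?A \<in> carrier_mat n n" using A by simp
  have sym': "?A\<^sup>T = ?A" using sym by (metis map_mat_transpose)
  define w where "w = ?A *\<^sub>v v"
  have w: "w \<in> carrier_vec n" unfolding w_def by (rule mult_mat_vec_carrier[OF A' v])
  have v': "conjugate v \<in> carrier_vec n" using v by simp
  have conj: "conjugate w = ?A *\<^sub>v conjugate v"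
    using A v by (intro eq_vecI) (auto simp: w_def scalar_prod_def)
  have "w \<bullet>c w = w \<bullet> (?A *\<^sub>v conjugate v)" by (simp add: conj)
  also have "\<dots> = (?A\<^sup>T *\<^sub>v w) \<bullet> conjugate v"
    using transpose_vec_mult_scalar[OF A' v' w] by simp
  also have "\<dots> = 0" using zero v' unfolding sym' w_def by simp
  finally show ?thesis using conjugate_square_eq_0_vec[OF w] by (simp add: w_def)
qed

lemma order_zero_char_poly_le_of_real:
  fixes A :: "real mat"
  assumes A: "A \<in> carrier_mat n n"
  shows "Polynomial.order 0 (char_poly A)
    \<le> Polynomial.order 0 (char_poly (map_mat complex_of_real A))"
proof -
  interpret h: map_poly_inj_idom_hom complex_of_real ..
  let ?p = "char_poly A"
  have hom: "char_poly (map_mat complex_of_real A) = map_poly complex_of_real ?p"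
    by (rule of_real_hom.char_poly_hom[OF A])
  have nz: "char_poly (map_mat complex_of_real A) \<noteq> 0"
    using degree_monic_char_poly[of "map_mat complex_of_real A" n] A by auto
  have "[:- 0, 1:] ^ Polynomial.order 0 ?p dvd ?p" by (rule order_1)
  then have "map_poly complex_of_real ([:0, 1:] ^ Polynomial.order 0 ?p) dvd map_poly complex_of_real ?p"
    by (simp add: h.hom_dvd)
  then have "[:- 0, 1:] ^ Polynomial.order 0 ?p dvd char_poly (map_mat complex_of_real A)"
    by (simp add: hom h.hom_power)
  then show ?thesis by (rule order_max) (rule nz)
qed

text \<open>
  Without symmetry this fails: the matrix whose two rows are both \<open>(1, -1)\<close> is nilpotent, so \<open>0\<close> has
  multiplicity \<open>2\<close>, yet its leading entry is a nonzero \<open>1 \<times> 1\<close> minor.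
\<close>

lemma order_zero_char_poly_add_minor_le:
  fixes A :: "real mat"
  assumes A: "A \<in> carrier_mat n n" and sym: "A\<^sup>T = A" and k: "k \<le> n"
    and minor: "det (mat k k (\<lambda>(i, j). A $$ (i, j))) \<noteq> 0"
  shows "Polynomial.order 0 (char_poly A) + k \<le> n"
proof -
  let ?A = "map_mat complex_of_real A"
  let ?M = "mat k k (\<lambda>(i, j). A $$ (i, j))"
  have A': "?A \<in> carrier_mat n n" using A by simp
  have "mat k k (\<lambda>(i, j). ?A $$ (i, j)) = map_mat complex_of_real ?M"
    using A k by (intro eq_matI) auto
  then have "det (mat k k (\<lambda>(i, j). ?A $$ (i, j))) \<noteq> 0"
    using minor by (simp add: of_real_hom.hom_det)
  then have "kernel_dim ?A + k \<le> n" by (rule kernel_dim_add_minor_le[OF A' k])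
  moreover have "Polynomial.order 0 (char_poly ?A) = kernel_dim ?A"
    using order_zero_char_poly_eq_kernel_dim[OF A'] kernel_square_of_real_symmetric[OF A sym]
    by blast
  ultimately show ?thesis using order_zero_char_poly_le_of_real[OF A] by linarith
qed

section \<open>Determinants of order at most four\<close>

lemma det_2:
  fixes A :: "'a :: comm_ring_1 mat"
  assumes A: "A \<in> carrier_mat 2 2"
  shows "det A = A $$ (0, 0) * A $$ (1, 1) - A $$ (0, 1) * A $$ (1, 0)"
proof -
  have s: "{..<2::nat} = {0, 1}" by auto
  show ?thesis
    by (subst laplace_expansion_row[OF A, of 0])
      (use A in \<open>auto simp: s cofactor_def mat_delete_def det_single\<close>)
qed

lemma det_3:
  fixes a :: "nat \<Rightarrow> nat \<Rightarrow> 'a :: comm_ring_1"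
  shows "det (mat 3 3 (\<lambda>(i, j). a i j)) =
     a 0 0 * (a 1 1 * a 2 2 - a 1 2 * a 2 1)
   - a 0 1 * (a 1 0 * a 2 2 - a 1 2 * a 2 0)
   + a 0 2 * (a 1 0 * a 2 1 - a 1 1 * a 2 0)"
proof -
  have s: "{..<3::nat} = {0, 1, 2}" by auto
  show ?thesis
    by (subst laplace_expansion_row[of _ 3 0])
      (auto simp: s cofactor_def mat_delete_def det_2 numeral_2_eq_2 algebra_simps)
qed

lemma det_4:
  fixes a :: "nat \<Rightarrow> nat \<Rightarrow> 'a :: comm_ring_1"
  shows "det (mat 4 4 (\<lambda>(i, j). a i j)) =
     a 0 0 * (a 1 1 * (a 2 2 * a 3 3 - a 2 3 * a 3 2) - a 1 2 * (a 2 1 * a 3 3 - a 2 3 * a 3 1)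
              + a 1 3 * (a 2 1 * a 3 2 - a 2 2 * a 3 1))
   - a 0 1 * (a 1 0 * (a 2 2 * a 3 3 - a 2 3 * a 3 2) - a 1 2 * (a 2 0 * a 3 3 - a 2 3 * a 3 0)
              + a 1 3 * (a 2 0 * a 3 2 - a 2 2 * a 3 0))
   + a 0 2 * (a 1 0 * (a 2 1 * a 3 3 - a 2 3 * a 3 1) - a 1 1 * (a 2 0 * a 3 3 - a 2 3 * a 3 0)
              + a 1 3 * (a 2 0 * a 3 1 - a 2 1 * a 3 0))
   - a 0 3 * (a 1 0 * (a 2 1 * a 3 2 - a 2 2 * a 3 1) - a 1 1 * (a 2 0 * a 3 2 - a 2 2 * a 3 0)
              + a 1 2 * (a 2 0 * a 3 1 - a 2 1 * a 3 0))"
proof -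
  have s: "{..<4::nat} = {0,1,2,3}" by auto
  let ?A = "mat 4 4 (\<lambda>(i, j). a i j)"
  have del: "mat_delete ?A 0 j =
      mat 3 3 (\<lambda>(r, c). a (Suc r) (if c < j then c else Suc c))" if "j < 4" for j
    using that by (intro eq_matI) (auto simp: mat_delete_def)
  have "det ?A = (\<Sum>j<4. a 0 j * cofactor ?A 0 j)"
    by (subst laplace_expansion_row[of _ 4 0]) auto
  also have "\<dots> = (\<Sum>j<4. a 0 j * ((-1) ^ j * det (mat 3 3 (\<lambda>(r, c). a (Suc r) (if c < j then c else Suc c)))))"
    by (intro sum.cong refl) (simp add: cofactor_def del)
  finally show ?thesis
    unfolding det_3 s by (simp add: numeral_2_eq_2 numeral_3_eq_3 algebra_simps)
qed

section \<open>Cycles in unicyclic graphs\<close>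

text \<open>
  A cycle as a vertex sequence, with a starting point and a direction: the form in which cycles are
  constructed and taken apart below.
\<close>

definition cycle_list :: "('a, 'b) ugraph_scheme \<Rightarrow> 'a list \<Rightarrow> bool" where
  "cycle_list G cs \<longleftrightarrow>
     distinct cs \<and> 3 \<le> length cs \<and> set cs \<subseteq> verts G \<and> cycle_edges cs \<subseteq> edges G"

lemma is_cycle_iff_cycle_list: "is_cycle G C \<longleftrightarrow> (\<exists>cs. cycle_list G cs \<and> C = cycle_edges cs)"
  by (auto simp: is_cycle_def cycle_list_def)

lemma cycle_edges_image:
  "cycle_edges cs = (\<lambda>i. {cs ! i, cs ! (Suc i mod length cs)}) ` {..<length cs}"
  by (auto simp: cycle_edges_def)

lemma cycle_edges_triple: "cycle_edges [a, b, c] = {{a, b}, {b, c}, {c, a}}"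
  by (auto simp: cycle_edges_image lessThan_Suc)

lemma cycle_edges_quadruple: "cycle_edges [a, b, c, d] = {{a, b}, {b, c}, {c, d}, {d, a}}"
  by (auto simp: cycle_edges_image lessThan_Suc)

lemma Union_cycle_edges: "\<Union> (cycle_edges cs) = set cs"
proof
  show "\<Union> (cycle_edges cs) \<subseteq> set cs"
    by (cases "cs = []") (auto simp: cycle_edges_image intro!: nth_mem)
  show "set cs \<subseteq> \<Union> (cycle_edges cs)"
    by (auto simp: cycle_edges_image in_set_conv_nth)
qed

text \<open>Rotation makes any vertex of a cycle its first one; the inclusion suffices for that.\<close>

lemma cycle_edges_rotate_subset: "cycle_edges (rotate k cs) \<subseteq> cycle_edges cs"
proof
  fix e assume "e \<in> cycle_edges (rotate k cs)"
  then obtain i where i: "i < length cs"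
    and e: "e = {rotate k cs ! i, rotate k cs ! (Suc i mod length cs)}"
    by (auto simp: cycle_edges_def)
  let ?j = "(k + i) mod length cs"
  have lt: "?j < length cs" "Suc i mod length cs < length cs"
    using i by (auto intro!: mod_less_divisor)
  have "e = {cs ! ?j, cs ! (Suc ?j mod length cs)}"
    unfolding e nth_rotate[OF i] nth_rotate[OF lt(2)] by (simp add: mod_simps)
  then show "e \<in> cycle_edges cs" using lt(1) by (auto simp: cycle_edges_def)
qed

lemma cycle_list_rotate: "cycle_list G cs \<Longrightarrow> cycle_list G (rotate k cs)"
  using cycle_edges_rotate_subset[of k cs] by (auto simp: cycle_list_def)

lemma cycle_list_edge:
  assumes "cycle_list G cs" and "Suc i < length cs"
  shows "{cs ! i, cs ! Suc i} \<in> edges G"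
proof -
  have "{cs ! i, cs ! (Suc i mod length cs)} \<in> cycle_edges cs"
    using assms(2) unfolding cycle_edges_image by (intro imageI) simp
  then show ?thesis using assms by (auto simp: cycle_list_def)
qed

text \<open>
  This is how uniqueness of the cycle is used: a cycle through a different vertex set or of a different
  length is a contradiction.  The edge set of a cycle determines both, as its union is the vertex set.
\<close>

lemma unicyclic_cycle_list_unique:
  assumes "unicyclic G" and "cycle_list G cs" and "cycle_list G ds"
  shows "cycle_edges ds = cycle_edges cs" and "set ds = set cs" and "length ds = length cs"
proof -
  show eq: "cycle_edges ds = cycle_edges cs"
    using assms unfolding unicyclic_def is_cycle_iff_cycle_list by blast
  then show set: "set ds = set cs" using Union_cycle_edges by metis
  show "length ds = length cs"
    using assms(2,3) distinct_card[of ds] distinct_card[of cs] set by (simp add: cycle_list_def)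
qed

lemma unicyclic_no_short_chord:
  assumes uni: "unicyclic G" and cs: "cycle_list G (a # b # c # d # es)"
  shows "{a, c} \<notin> edges G"
proof
  assume "{a, c} \<in> edges G"
  then have "cycle_list G [a, b, c]"
    using cs cycle_list_edge[OF cs, of 0] cycle_list_edge[OF cs, of 1]
    by (auto simp: cycle_list_def cycle_edges_triple insert_commute)
  from unicyclic_cycle_list_unique(3)[OF uni cs this] show False by simp
qed

lemma connected_graph_crossing_edge:
  assumes "connected_graph G" and "S \<subseteq> verts G" and "u \<in> S" and "x \<in> verts G" "x \<notin> S"
  obtains a b where "a \<in> S" and "b \<notin> S" and "{a, b} \<in> edges G"
proof -
  have path: "(u, x) \<in> {(x, y). {x, y} \<in> edges G}\<^sup>*"
    using assms unfolding connected_graph_def by blast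
  have "x \<in> S \<or> (\<exists>a b. a \<in> S \<and> b \<notin> S \<and> {a, b} \<in> edges G)"
    using path by (induction rule: rtrancl_induct) (use assms(3) in auto)
  then show thesis using that assms(5) by blast
qed

section \<open>Bounding the nullity by a principal minor\<close>

lemma signed_graph_edgeD:
  assumes "signed_graph \<Gamma>" and "{u, v} \<in> edges \<Gamma>"
  shows "u \<in> verts \<Gamma>" and "v \<in> verts \<Gamma>" and "u \<noteq> v"
    and "edge_sign \<Gamma> {u, v} = 1 \<or> edge_sign \<Gamma> {u, v} = -1"
  using assms by (auto simp: signed_graph_def simple_graph_def doubleton_eq_iff)

lemma signed_adj_commute: "signed_adj \<Gamma> u v = signed_adj \<Gamma> v u"
  by (simp add: signed_adj_def adj_def insert_commute)

lemma signed_adj_edge: "{u, v} \<in> edges \<Gamma> \<Longrightarrow> signed_adj \<Gamma> u v = edge_sign \<Gamma> {u, v}"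
  by (simp add: signed_adj_def adj_def)

lemma signed_adj_nonedge: "{u, v} \<notin> edges \<Gamma> \<Longrightarrow> signed_adj \<Gamma> u v = 0"
  by (simp add: signed_adj_def adj_def)

lemma signed_adj_self: "signed_graph \<Gamma> \<Longrightarrow> signed_adj \<Gamma> u u = 0"
  using signed_graph_edgeD(3)[of \<Gamma> u u] by (intro signed_adj_nonedge) auto

text \<open>
  The enumeration of the vertices is arbitrary, so the leading minors reach every principal minor.
\<close>

lemma nullity_add_minor_le:
  assumes vs: "distinct vs" "set vs = verts \<Gamma>" and k: "k \<le> length vs"
    and minor: "det (mat k k (\<lambda>(i, j). real_of_int (signed_adj \<Gamma> (vs ! i) (vs ! j)))) \<noteq> 0"
  shows "nullity \<Gamma> + k \<le> card (verts \<Gamma>)"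
proof -
  let ?A = "adj_matrix \<Gamma> vs"
  have A: "?A \<in> carrier_mat (length vs) (length vs)" by (simp add: adj_matrix_def)
  have "?A\<^sup>T = ?A"
    by (intro eq_matI) (auto simp: adj_matrix_def signed_adj_commute)
  moreover have "mat k k (\<lambda>(i, j). ?A $$ (i, j)) =
      mat k k (\<lambda>(i, j). real_of_int (signed_adj \<Gamma> (vs ! i) (vs ! j)))"
    using k by (intro eq_matI) (auto simp: adj_matrix_def)
  ultimately have "Polynomial.order 0 (char_poly ?A) + k \<le> length vs"
    using order_zero_char_poly_add_minor_le[OF A _ k] minor by simp
  then show ?thesis using nullity_eq[OF vs] distinct_card[OF vs(1)] vs(2) by simp
qed

text \<open>
  The two products in the last hypothesis belong to the matchings \<open>wx, yz\<close> and \<open>wz, xy\<close>; the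
  hypothesis before it excludes the matching \<open>wy, xz\<close>.
\<close>

lemma nullity_add_four_le:
  assumes \<Gamma>: "signed_graph \<Gamma>"
    and d: "distinct [w, x, y, z]" "{w, x, y, z} \<subseteq> verts \<Gamma>"
    and q: "signed_adj \<Gamma> w y * signed_adj \<Gamma> x z = 0"
    and pr: "signed_adj \<Gamma> w x * signed_adj \<Gamma> y z \<noteq> signed_adj \<Gamma> w z * signed_adj \<Gamma> x y"
  shows "nullity \<Gamma> + 4 \<le> card (verts \<Gamma>)"
proof -
  have fin: "finite (verts \<Gamma>)" using \<Gamma> by (simp add: signed_graph_def simple_graph_def)
  then obtain rest where rest: "set rest = verts \<Gamma> - {w, x, y, z}" "distinct rest"
    using finite_distinct_list[of "verts \<Gamma> - {w, x, y, z}"] by auto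
  define vs where "vs = [w, x, y, z] @ rest"
  have vs: "distinct vs" "set vs = verts \<Gamma>" "4 \<le> length vs"
    using d rest by (auto simp: vs_def)
  define s where "s u v = real_of_int (signed_adj \<Gamma> u v)" for u v
  have diag: "s u u = 0" for u by (simp add: s_def signed_adj_self[OF \<Gamma>])
  have sym: "s x w = s w x" "s y w = s w y" "s z w = s w z"
    "s y x = s x y" "s z x = s x z" "s z y = s y z"
    by (simp_all add: s_def signed_adj_commute)
  have q': "s w y * s x z = 0" using q by (simp add: s_def flip: of_int_mult)
  have pr': "s w x * s y z \<noteq> s w z * s x y" using pr by (simp add: s_def flip: of_int_mult)
  have nth: "vs ! 0 = w" "vs ! 1 = x" "vs ! 2 = y" "vs ! 3 = z"
    by (simp_all add: vs_def numeral_2_eq_2 numeral_3_eq_3)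
  have "det (mat 4 4 (\<lambda>(i, j). s (vs ! i) (vs ! j))) =
      (s w x * s y z - s w z * s x y)\<^sup>2
      + s w y * s x z * (s w y * s x z - 2 * (s w x * s y z) - 2 * (s w z * s x y))"
    unfolding det_4 nth diag sym by (simp add: algebra_simps power2_eq_square)
  also have "\<dots> = (s w x * s y z - s w z * s x y)\<^sup>2" unfolding q' by simp
  also have "\<dots> \<noteq> 0" using pr' by simp
  finally show ?thesis using nullity_add_minor_le[OF vs] by (simp add: s_def)
qed

section \<open>Unicyclic signed graphs of nullity at least n - 3\<close>

text \<open>
  Otherwise an edge \<open>ax\<close> leaves the cycle.  With \<open>b\<close> and \<open>c\<close> the two vertices that follow \<open>a\<close> on the
  cycle, \<open>xa, bc\<close> is the only perfect matching of \<open>x, a, b, c\<close>: an edge \<open>xb\<close> or \<open>xc\<close> would create a cycle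
  through \<open>x\<close>.  This covers triangles too, where \<open>ca\<close> is an edge but completes no matching.
\<close>

lemma large_nullity_imp_spanning_cycle:
  assumes \<Gamma>: "signed_graph \<Gamma>" and uni: "unicyclic \<Gamma>" and cs: "cycle_list \<Gamma> cs"
    and large: "card (verts \<Gamma>) < nullity \<Gamma> + 4"
  shows "set cs = verts \<Gamma>"
proof (rule ccontr)
  assume "set cs \<noteq> verts \<Gamma>"
  moreover have sub: "set cs \<subseteq> verts \<Gamma>" "3 \<le> length cs" using cs by (auto simp: cycle_list_def)
  ultimately obtain y where y: "y \<in> verts \<Gamma>" "y \<notin> set cs" by blast
  have "cs ! 0 \<in> set cs" using sub(2) by (intro nth_mem) linarith
  then obtain a x where a: "a \<in> set cs" and x: "x \<notin> set cs" and ax: "{a, x} \<in> edges \<Gamma>"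
    using connected_graph_crossing_edge[OF _ sub(1) _ y] uni unfolding unicyclic_def by metis
  obtain i where i: "i < length cs" "cs ! i = a" using a by (auto simp: in_set_conv_nth)
  define ds where "ds = rotate i cs"
  have ds: "cycle_list \<Gamma> ds" "set ds = set cs"
    using cycle_list_rotate[OF cs] by (simp_all add: ds_def)
  then obtain b c es where "ds = ds ! 0 # b # c # es"
    unfolding cycle_list_def by (auto simp: numeral_3_eq_3 Suc_le_length_iff)
  moreover have "ds ! 0 = a"
  proof -
    have "0 < length cs" using i(1) by linarith
    from nth_rotate[OF this, of i] show ?thesis using i by (simp add: ds_def)
  qed
  ultimately have abc: "ds = a # b # c # es" by simp
  have ab: "{a, b} \<in> edges \<Gamma>" and bc: "{b, c} \<in> edges \<Gamma>"
    using cycle_list_edge[OF ds(1), of 0] cycle_list_edge[OF ds(1), of 1] abc by simp_all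
  have mem: "a \<in> verts \<Gamma>" "b \<in> verts \<Gamma>" "c \<in> verts \<Gamma>" "x \<in> verts \<Gamma>"
    using signed_graph_edgeD[OF \<Gamma>] ax bc by blast+
  have dist: "distinct [x, a, b, c]" using ds x abc by (auto simp: cycle_list_def)
  have no_cycle: "\<not> cycle_list \<Gamma> fs" if "x \<in> set fs" for fs
    using unicyclic_cycle_list_unique(2)[OF uni cs] x that by metis
  have "{x, b} \<notin> edges \<Gamma>"
    using no_cycle[of "[x, a, b]"] ax ab mem dist
    by (auto simp: cycle_list_def cycle_edges_triple insert_commute)
  moreover have "{x, c} \<notin> edges \<Gamma>"
    using no_cycle[of "[x, a, b, c]"] ax ab bc mem dist
    by (auto simp: cycle_list_def cycle_edges_quadruple insert_commute)
  moreover have xa: "{x, a} \<in> edges \<Gamma>" using ax by (simp add: insert_commute)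
  moreover have "signed_adj \<Gamma> x a * signed_adj \<Gamma> b c \<noteq> 0"
    using signed_graph_edgeD(4)[OF \<Gamma> xa] signed_graph_edgeD(4)[OF \<Gamma> bc]
      signed_adj_edge[OF xa] signed_adj_edge[OF bc] by auto
  ultimately have "nullity \<Gamma> + 4 \<le> card (verts \<Gamma>)"
    using mem by (intro nullity_add_four_le[OF \<Gamma> dist]) (simp_all add: signed_adj_nonedge)
  then show False using large by simp
qed

text \<open>
  Four consecutive vertices of a longer cycle induce a path, since a chord would close a triangle or a
  quadrilateral.  A path on four vertices has exactly one perfect matching.
\<close>

lemma large_nullity_imp_cycle_length_le_4:
  assumes \<Gamma>: "signed_graph \<Gamma>" and uni: "unicyclic \<Gamma>" and cs: "cycle_list \<Gamma> cs"
    and large: "card (verts \<Gamma>) < nullity \<Gamma> + 4"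
  shows "length cs \<le> 4"
proof (rule ccontr)
  assume "\<not> length cs \<le> 4"
  then have "Suc (Suc (Suc (Suc (Suc 0)))) \<le> length cs" by simp
  then obtain a b c d e es where abcd: "cs = a # b # c # d # e # es"
    by (auto simp: Suc_le_length_iff)
  note cs' = cs[unfolded abcd]
  have ab: "{a, b} \<in> edges \<Gamma>" and bc: "{b, c} \<in> edges \<Gamma>" and cd: "{c, d} \<in> edges \<Gamma>"
    using cycle_list_edge[OF cs', of 0] cycle_list_edge[OF cs', of 1] cycle_list_edge[OF cs', of 2]
    by (simp_all add: numeral_2_eq_2)
  have dist: "distinct [a, b, c, d]" and mem: "{a, b, c, d} \<subseteq> verts \<Gamma>"
    using cs' by (auto simp: cycle_list_def)
  have "{a, d} \<notin> edges \<Gamma>"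
  proof
    assume "{a, d} \<in> edges \<Gamma>"
    then have "cycle_list \<Gamma> [a, b, c, d]"
      using ab bc cd dist mem by (auto simp: cycle_list_def cycle_edges_quadruple insert_commute)
    from unicyclic_cycle_list_unique(3)[OF uni cs' this] show False by simp
  qed
  moreover have "{a, c} \<notin> edges \<Gamma>" by (rule unicyclic_no_short_chord[OF uni cs'])
  moreover have "signed_adj \<Gamma> a b * signed_adj \<Gamma> c d \<noteq> 0"
    using signed_graph_edgeD(4)[OF \<Gamma> ab] signed_graph_edgeD(4)[OF \<Gamma> cd]
      signed_adj_edge[OF ab] signed_adj_edge[OF cd] by auto
  ultimately have "nullity \<Gamma> + 4 \<le> card (verts \<Gamma>)"
    by (intro nullity_add_four_le[OF \<Gamma> dist mem]) (simp_all add: signed_adj_nonedge)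
  then show False using large by simp
qed

lemma cycle_sign_quadruple:
  assumes "distinct [a, b, c, d]"
  shows "cycle_sign \<Gamma> (cycle_edges [a, b, c, d]) =
    edge_sign \<Gamma> {a, b} * edge_sign \<Gamma> {b, c} * edge_sign \<Gamma> {c, d} * edge_sign \<Gamma> {d, a}"
proof -
  have "{b, c} \<noteq> {c, d}" "{b, c} \<noteq> {d, a}" "{c, d} \<noteq> {d, a}"
    "{a, b} \<noteq> {b, c}" "{a, b} \<noteq> {c, d}" "{a, b} \<noteq> {d, a}"
    using assms by (auto simp: doubleton_eq_iff)
  then show ?thesis by (simp add: cycle_sign_def cycle_edges_quadruple mult.assoc)
qed

text \<open>
  A spanning cycle of length three leaves no room for further edges.  In a spanning cycle of length
  four both diagonals would close a triangle, and the determinant formula then reads off the sign.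
\<close>

lemma large_nullity_imp_C3_or_balanced_C4:
  assumes \<Gamma>: "signed_graph \<Gamma>" and uni: "unicyclic \<Gamma>"
    and large: "card (verts \<Gamma>) < nullity \<Gamma> + 4"
  shows "is_cycle_graph 3 \<Gamma> \<or> is_cycle_graph 4 \<Gamma> \<and> balanced \<Gamma>"
proof -
  obtain cs where cs: "cycle_list \<Gamma> cs"
    using uni unfolding unicyclic_def is_cycle_iff_cycle_list by blast
  have verts: "set cs = verts \<Gamma>" by (rule large_nullity_imp_spanning_cycle[OF \<Gamma> uni cs large])
  have dist: "distinct cs" and sub: "cycle_edges cs \<subseteq> edges \<Gamma>"
    using cs by (simp_all add: cycle_list_def)
  have "\<forall>e \<in> edges \<Gamma>. \<exists>u \<in> verts \<Gamma>. \<exists>v \<in> verts \<Gamma>. u \<noteq> v \<and> e = {u, v}"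
    using \<Gamma> by (simp add: signed_graph_def simple_graph_def)
  then have edge: "\<exists>u v. e = {u, v} \<and> u \<in> set cs \<and> v \<in> set cs \<and> u \<noteq> v"
    if "e \<in> edges \<Gamma>" for e
    unfolding verts using that by blast
  consider "length cs = 3" | "length cs = 4"
    using large_nullity_imp_cycle_length_le_4[OF \<Gamma> uni cs large] cs
    by (auto simp: cycle_list_def le_Suc_eq numeral_eq_Suc)
  then show ?thesis
  proof cases
    case 1
    then obtain a b c where abc: "cs = [a, b, c]"
      by (auto simp: numeral_3_eq_3 length_Suc_conv)
    have "edges \<Gamma> \<subseteq> cycle_edges cs"
    proof
      fix e assume "e \<in> edges \<Gamma>"
      then show "e \<in> cycle_edges cs"
        using edge[of e] by (auto simp: abc cycle_edges_triple insert_commute)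
    qed
    then show ?thesis using 1 dist verts sub unfolding is_cycle_graph_def by blast
  next
    case 2
    then obtain a b c d where abcd: "cs = [a, b, c, d]"
      by (auto simp: numeral_eq_Suc length_Suc_conv)
    note cs' = cs[unfolded abcd]
    have dist': "distinct [a, b, c, d]" and mem: "{a, b, c, d} \<subseteq> verts \<Gamma>"
      using cs' by (auto simp: cycle_list_def)
    have ed: "{a, b} \<in> edges \<Gamma>" "{b, c} \<in> edges \<Gamma>" "{c, d} \<in> edges \<Gamma>" "{a, d} \<in> edges \<Gamma>"
      using sub by (auto simp: abcd cycle_edges_quadruple insert_commute)
    have ac: "{a, c} \<notin> edges \<Gamma>" by (rule unicyclic_no_short_chord[OF uni cs'])
    have "cycle_list \<Gamma> [b, c, d, a]" using cycle_list_rotate[OF cs', of 1] by simp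
    then have bd: "{b, d} \<notin> edges \<Gamma>" by (rule unicyclic_no_short_chord[OF uni])
    have "edges \<Gamma> \<subseteq> cycle_edges cs"
    proof
      fix e assume "e \<in> edges \<Gamma>"
      then show "e \<in> cycle_edges cs"
        using edge[of e] ac bd by (auto simp: abcd cycle_edges_quadruple insert_commute)
    qed
    then have C4: "is_cycle_graph 4 \<Gamma>" using 2 dist verts sub unfolding is_cycle_graph_def by blast
    have "signed_adj \<Gamma> a b * signed_adj \<Gamma> c d = signed_adj \<Gamma> a d * signed_adj \<Gamma> b c"
      using nullity_add_four_le[OF \<Gamma> dist' mem] ac large by (auto simp: signed_adj_nonedge)
    then have "edge_sign \<Gamma> {a, b} * edge_sign \<Gamma> {c, d} = edge_sign \<Gamma> {a, d} * edge_sign \<Gamma> {b, c}"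
      by (simp add: signed_adj_edge ed)
    then have "cycle_sign \<Gamma> (cycle_edges cs) = 1"
      using signed_graph_edgeD(4)[OF \<Gamma> ed(1)] signed_graph_edgeD(4)[OF \<Gamma> ed(2)]
        signed_graph_edgeD(4)[OF \<Gamma> ed(3)] signed_graph_edgeD(4)[OF \<Gamma> ed(4)]
      unfolding abcd cycle_sign_quadruple[OF dist'] by (auto simp: insert_commute)
    then have "balanced \<Gamma>"
      using unicyclic_cycle_list_unique(1)[OF uni cs]
      unfolding balanced_def is_cycle_iff_cycle_list by metis
    then show ?thesis using C4 by blast
  qed
qed

section \<open>The nullities of the two exceptional cycles\<close>

text \<open>The determinant is twice the sign of the triangle, hence nonzero for either sign.\<close>

lemma nullity_C3:
  assumes \<Gamma>: "signed_graph \<Gamma>" and C3: "is_cycle_graph 3 \<Gamma>"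
  shows "nullity \<Gamma> = 0" and "card (verts \<Gamma>) = 3"
proof -
  obtain cs where cs: "distinct cs" "length cs = 3" "set cs = verts \<Gamma>" "edges \<Gamma> = cycle_edges cs"
    using C3 unfolding is_cycle_graph_def by blast
  show card: "card (verts \<Gamma>) = 3" using distinct_card[OF cs(1)] cs by simp
  obtain a b c where abc: "cs = [a, b, c]"
    using cs(2) by (auto simp: numeral_3_eq_3 length_Suc_conv)
  define s where "s u v = real_of_int (signed_adj \<Gamma> u v)" for u v
  have ed: "{a, b} \<in> edges \<Gamma>" "{b, c} \<in> edges \<Gamma>" "{a, c} \<in> edges \<Gamma>"
    by (auto simp: cs(4) abc cycle_edges_triple)
  have nz: "s a b \<noteq> 0" "s b c \<noteq> 0" "s a c \<noteq> 0"
    using signed_graph_edgeD(4)[OF \<Gamma> ed(1)] signed_graph_edgeD(4)[OF \<Gamma> ed(2)]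
      signed_graph_edgeD(4)[OF \<Gamma> ed(3)] by (auto simp: s_def signed_adj_edge ed)
  have diag: "s u u = 0" for u by (simp add: s_def signed_adj_self[OF \<Gamma>])
  have sym: "s b a = s a b" "s c a = s a c" "s c b = s b c"
    by (simp_all add: s_def signed_adj_commute)
  have nth: "cs ! 0 = a" "cs ! 1 = b" "cs ! 2 = c"
    by (simp_all add: abc numeral_2_eq_2)
  have "det (mat 3 3 (\<lambda>(i, j). s (cs ! i) (cs ! j))) = 2 * (s a b * s b c * s a c)"
    unfolding det_3 nth diag sym by (simp add: algebra_simps)
  then have "nullity \<Gamma> + 3 \<le> card (verts \<Gamma>)"
    using nullity_add_minor_le[OF cs(1,3), of 3] cs(2) nz by (simp add: s_def)
  then show "nullity \<Gamma> = 0" using card by simp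
qed

text \<open>
  With \<open>p\<close> and \<open>r\<close> the products of the signs along the two pairs of opposite edges, the characteristic
  polynomial of a signed quadrilateral is \<open>X\<^sup>4 - 4X\<^sup>2 + (p - r)\<^sup>2\<close>, and \<open>p = r\<close> when the cycle is
  positive.  For the other inequality a single edge provides a nonsingular \<open>2 \<times> 2\<close> minor.
\<close>

lemma nullity_balanced_C4:
  assumes \<Gamma>: "signed_graph \<Gamma>" and C4: "is_cycle_graph 4 \<Gamma>" and bal: "balanced \<Gamma>"
  shows "nullity \<Gamma> = 2" and "card (verts \<Gamma>) = 4"
proof -
  obtain cs where cs: "distinct cs" "length cs = 4" "set cs = verts \<Gamma>" "edges \<Gamma> = cycle_edges cs"
    using C4 unfolding is_cycle_graph_def by blast
  show card: "card (verts \<Gamma>) = 4" using distinct_card[OF cs(1)] cs by simp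
  obtain a b c d where abcd: "cs = [a, b, c, d]"
    using cs(2) by (auto simp: numeral_eq_Suc length_Suc_conv)
  have dist: "distinct [a, b, c, d]" using cs(1) abcd by simp
  define s where "s u v = real_of_int (signed_adj \<Gamma> u v)" for u v
  have ed: "{a, b} \<in> edges \<Gamma>" "{b, c} \<in> edges \<Gamma>" "{c, d} \<in> edges \<Gamma>" "{a, d} \<in> edges \<Gamma>"
    by (auto simp: cs(4) abcd cycle_edges_quadruple insert_commute)
  have chord: "{a, c} \<notin> edges \<Gamma>" "{b, d} \<notin> edges \<Gamma>"
    using dist by (auto simp: cs(4) abcd cycle_edges_quadruple doubleton_eq_iff)
  have diag: "s u u = 0" for u by (simp add: s_def signed_adj_self[OF \<Gamma>])
  have sym: "s b a = s a b" "s c b = s b c" "s d c = s c d" "s d a = s a d"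
    by (simp_all add: s_def signed_adj_commute)
  have zero: "s a c = 0" "s c a = 0" "s b d = 0" "s d b = 0"
    using chord by (simp_all add: s_def signed_adj_nonedge insert_commute)
  have "cycle_list \<Gamma> cs" using cs by (simp add: cycle_list_def)
  then have "cycle_sign \<Gamma> (cycle_edges [a, b, c, d]) = 1"
    using bal abcd unfolding balanced_def is_cycle_iff_cycle_list by blast
  then have "edge_sign \<Gamma> {a, b} * edge_sign \<Gamma> {c, d} = edge_sign \<Gamma> {a, d} * edge_sign \<Gamma> {b, c}"
    using signed_graph_edgeD(4)[OF \<Gamma> ed(1)] signed_graph_edgeD(4)[OF \<Gamma> ed(2)]
      signed_graph_edgeD(4)[OF \<Gamma> ed(3)] signed_graph_edgeD(4)[OF \<Gamma> ed(4)]
    unfolding cycle_sign_quadruple[OF dist] by (auto simp: insert_commute)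
  then have pr: "s a b * s c d = s a d * s b c"
    by (simp add: s_def signed_adj_edge ed flip: of_int_mult)
  let ?A = "adj_matrix \<Gamma> cs"
  let ?X = "[:0, 1:] :: real poly"
  define t where "t u v = [:- s u v:]" for u v
  have A: "?A \<in> carrier_mat 4 4" by (simp add: adj_matrix_def cs(2))
  have M: "char_poly_matrix ?A = mat 4 4 (\<lambda>(i, j). if i = j then ?X else t (cs ! i) (cs ! j))"
    using cs(2) by (intro eq_matI)
      (auto simp: char_poly_matrix_def adj_matrix_def t_def signed_adj_self[OF \<Gamma>] s_def)
  have nth: "cs ! 0 = a" "cs ! 1 = b" "cs ! 2 = c" "cs ! 3 = d"
    by (simp_all add: abcd numeral_2_eq_2 numeral_3_eq_3)
  have t: "t b a = t a b" "t c b = t b c" "t d c = t c d" "t d a = t a d"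
    "t a c = 0" "t c a = 0" "t b d = 0" "t d b = 0"
    by (simp_all add: t_def sym zero)
  \<comment> \<open>The product rules for polynomial literals would multiply \<open>X\<close> out before the two sides are
    compared as elements of a commutative ring.\<close>
  have "char_poly ?A =
      ?X\<^sup>2 * (?X\<^sup>2 - ((t a b)\<^sup>2 + (t b c)\<^sup>2 + (t c d)\<^sup>2 + (t a d)\<^sup>2))
      + (t a b * t c d - t a d * t b c)\<^sup>2"
    unfolding char_poly_def M det_4 nth t
    by (simp add: algebra_simps power2_eq_square del: mult_pCons_left mult_pCons_right)
  also have "t a b * t c d = t a d * t b c" using pr by (simp add: t_def mult.commute)
  finally have "char_poly ?A =
      ?X\<^sup>2 * (?X\<^sup>2 - ((t a b)\<^sup>2 + (t b c)\<^sup>2 + (t c d)\<^sup>2 + (t a d)\<^sup>2))"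
    by simp
  then have "[:- 0, 1:]\<^sup>2 dvd char_poly ?A" by simp
  moreover have "char_poly ?A \<noteq> 0" using degree_monic_char_poly[OF A] by auto
  ultimately have "2 \<le> nullity \<Gamma>" unfolding nullity_eq[OF cs(1,3)] by (rule order_max)
  moreover have "nullity \<Gamma> + 2 \<le> card (verts \<Gamma>)"
  proof (rule nullity_add_minor_le[OF cs(1,3)])
    let ?M = "mat 2 2 (\<lambda>(i, j). real_of_int (signed_adj \<Gamma> (cs ! i) (cs ! j)))"
    have "det ?M = - (s a b)\<^sup>2"
      using det_2[of ?M] 
      by (simp add: abcd s_def signed_adj_self[OF \<Gamma>] power2_eq_square signed_adj_commute)
    moreover have "s a b \<noteq> 0"
      using signed_graph_edgeD(4)[OF \<Gamma> ed(1)] by (auto simp: s_def signed_adj_edge ed)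
    ultimately show "det ?M \<noteq> 0" by simp
  qed (simp add: cs(2))
  ultimately show "nullity \<Gamma> = 2" using card by simp
qed

section \<open>Unicyclic signed graphs with nullity n - 2 and n - 3\<close>

theorem theorem3p2:
  fixes \<Gamma> :: "'a signed_graph" and n :: nat
  assumes "signed_graph \<Gamma>"
    and "unicyclic \<Gamma>"
    and "card (verts \<Gamma>) = n"
  shows "(int (nullity \<Gamma>) = int n - 2 \<longleftrightarrow> is_cycle_graph 4 \<Gamma> \<and> balanced \<Gamma>) \<and>
         (int (nullity \<Gamma>) = int n - 3 \<longleftrightarrow> is_cycle_graph 3 \<Gamma>)"
proof -
  have "is_cycle_graph 3 \<Gamma> \<or> is_cycle_graph 4 \<Gamma> \<and> balanced \<Gamma>"
    if "int (nullity \<Gamma>) = int n - 2 \<or> int (nullity \<Gamma>) = int n - 3"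
    using large_nullity_imp_C3_or_balanced_C4[OF assms(1,2)] that assms(3) by linarith
  moreover have "nullity \<Gamma> = 0 \<and> n = 3" if "is_cycle_graph 3 \<Gamma>"
    using nullity_C3[OF assms(1) that] assms(3) by simp
  moreover have "nullity \<Gamma> = 2 \<and> n = 4" if "is_cycle_graph 4 \<Gamma> \<and> balanced \<Gamma>"
    using nullity_balanced_C4[OF assms(1)] that assms(3) by simp
  ultimately show ?thesis by auto
qed

end
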